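(* Let $K\ge 1$ and $k=(K-1)/(K+1)$. Suppose that $f(z)=h(z)+\overline{g(z)}=\sum_{n=0}^{\infty}a_n z^n+\overline{\sum_{n=2}^{\infty}b_n z^n}$ is a $K$-quasiconformal sense-preserving harmonic mapping in $\mathbb{D}$ and $h\prec \varphi$, where $\varphi$ is analytic, univalent and convex in $\mathbb{D}$. Then $$\sum_{n=1}^{\infty}|a_n|r^n+\sum_{n=2}^{\infty}|b_n|r^n\leq \operatorname{dist}(\varphi(0),\partial\varphi(\mathbb{D}))$$ for $|z|=r\leq r_c(k)$, where $r_c(k)$ is the positive root (in $(0,1)$) of the equation $$\frac{r}{1-r}+\frac{kr^2}{1-r^2}\sqrt{\left(\frac{1+r^2}{1-r^2}\right)\left(\frac{\pi^2}{6}-1\right)}=\frac{1}{2}.$$ Moreover, the number $r_c(k)$ cannot be replaced by a number greater than $R=R(k)$, where $R$ is the positive root (in $(0,1)$) of the equation $$\frac{2(1+k)R}{1-R}+2k\log(1-R)=1;$$ that is, for every $\rho\in(R(k),1)$ there exist $f$ and $\varphi$ satisfying the hypotheses for which the inequality fails for some $r\le\rho$.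
   Context: $\mathbb{D}=\{z\in\mathbb{C}:|z|<1\}$. A harmonic mapping $f$ in $\mathbb{D}$ is a complex-valued function whose real and imaginary parts are harmonic; it is written $f=h+\overline{g}$ with $h,g$ analytic in $\mathbb{D}$ and $g(0)=0$, with power series coefficients $a_n$ of $h$ and $b_n$ of $g$ (here $b_1=0$). A locally univalent harmonic mapping $f=h+\overline{g}$ is sense-preserving if $|h'(z)|^2-|g'(z)|^2>0$ in $\mathbb{D}$ (equivalently, the dilatation $\omega=g'/h'$ is analytic and maps $\mathbb{D}$ into itself). A locally univalent sense-preserving harmonic mapping is called $K$-quasiconformal if $|g'(z)/h'(z)|\le k<1$ in $\mathbb{D}$, where $K=\frac{1+k}{1-k}\ge 1$. For analytic $h,\varphi$ in $\mathbb{D}$ with $h(0)=\varphi(0)$, $h\prec\varphi$ ($h$ is subordinate to $\varphi$) means $h(z)=\varphi(w(z))$ for some analytic $w$ on $\mathbb{D}$ with $|w(z)|\le|z|$. A univalent $\varphi$ is convex if $\varphi(\mathbb{D})$ is a convex domain. $\operatorname{dist}(\varphi(0),\partial\varphi(\mathbb{D}))$ is the Euclidean distance from $\varphi(0)$ to the boundary of $\varphi(\mathbb{D})$. *)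

theory Defs
  imports "HOL-Complex_Analysis.Complex_Analysis"
begin

abbreviation unit_disc :: "complex set" where
  "unit_disc \<equiv> ball 0 1"

(* u is twice continuously differentiable with vanishing Laplacian; ux, uy are the first-order
   and uxx, uxy, uyx, uyy the second-order partial derivatives in the coordinates Re z, Im z. *)
definition harmonic_on :: "(complex \<Rightarrow> real) \<Rightarrow> complex set \<Rightarrow> bool" where
  "harmonic_on u S \<longleftrightarrow> open S \<and>
     (\<exists>ux uy uxx uxy uyx uyy.
        (\<forall>z\<in>S. (u has_derivative (\<lambda>v. Re v * ux z + Im v * uy z)) (at z)) \<and>
        (\<forall>z\<in>S. (ux has_derivative (\<lambda>v. Re v * uxx z + Im v * uxy z)) (at z)) \<and>
        (\<forall>z\<in>S. (uy has_derivative (\<lambda>v. Re v * uyx z + Im v * uyy z)) (at z)) \<and>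
        continuous_on S uxx \<and> continuous_on S uxy \<and>
        continuous_on S uyx \<and> continuous_on S uyy \<and>
        (\<forall>z\<in>S. uxx z + uyy z = 0))"

definition harmonic_mapping :: "(complex \<Rightarrow> complex) \<Rightarrow> bool" where
  "harmonic_mapping f \<longleftrightarrow>
     harmonic_on (\<lambda>z. Re (f z)) unit_disc \<and> harmonic_on (\<lambda>z. Im (f z)) unit_disc"

definition canonical_decomposition ::
    "(complex \<Rightarrow> complex) \<Rightarrow> (complex \<Rightarrow> complex) \<Rightarrow> (complex \<Rightarrow> complex) \<Rightarrow> bool" where
  "canonical_decomposition f h g \<longleftrightarrow>
     h holomorphic_on unit_disc \<and> g holomorphic_on unit_disc \<and> g 0 = 0 \<and>
     (\<forall>z\<in>unit_disc. f z = h z + cnj (g z))"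

definition locally_univalent :: "(complex \<Rightarrow> complex) \<Rightarrow> bool" where
  "locally_univalent f \<longleftrightarrow>
     (\<forall>z\<in>unit_disc. \<exists>U. open U \<and> z \<in> U \<and> U \<subseteq> unit_disc \<and> inj_on f U)"

(* The difference below is the Jacobian of h + cnj g. *)
definition sense_preserving :: "(complex \<Rightarrow> complex) \<Rightarrow> (complex \<Rightarrow> complex) \<Rightarrow> bool" where
  "sense_preserving h g \<longleftrightarrow>
     (\<forall>z\<in>unit_disc. (norm (deriv h z))\<^sup>2 - (norm (deriv g z))\<^sup>2 > 0)"

definition quasiconformal_harmonic ::
    "real \<Rightarrow> (complex \<Rightarrow> complex) \<Rightarrow> (complex \<Rightarrow> complex) \<Rightarrow> (complex \<Rightarrow> complex) \<Rightarrow> bool" where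
  "quasiconformal_harmonic K f h g \<longleftrightarrow>
     harmonic_mapping f \<and> canonical_decomposition f h g \<and>
     locally_univalent f \<and> sense_preserving h g \<and>
     (\<exists>k. 0 \<le> k \<and> k < 1 \<and> K = (1 + k) / (1 - k) \<and>
          (\<forall>z\<in>unit_disc. norm (deriv g z / deriv h z) \<le> k))"

definition subordinate :: "(complex \<Rightarrow> complex) \<Rightarrow> (complex \<Rightarrow> complex) \<Rightarrow> bool" where
  "subordinate h \<phi> \<longleftrightarrow>
     h holomorphic_on unit_disc \<and> \<phi> holomorphic_on unit_disc \<and> h 0 = \<phi> 0 \<and>
     (\<exists>w. w holomorphic_on unit_disc \<and>
          (\<forall>z\<in>unit_disc. norm (w z) \<le> norm z \<and> h z = \<phi> (w z)))"

definition convex_univalent :: "(complex \<Rightarrow> complex) \<Rightarrow> bool" where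
  "convex_univalent \<phi> \<longleftrightarrow>
     \<phi> holomorphic_on unit_disc \<and> inj_on \<phi> unit_disc \<and> convex (\<phi> ` unit_disc)"

definition bohr_hypotheses ::
    "real \<Rightarrow> (complex \<Rightarrow> complex) \<Rightarrow> (complex \<Rightarrow> complex) \<Rightarrow> (complex \<Rightarrow> complex) \<Rightarrow>
     (nat \<Rightarrow> complex) \<Rightarrow> (nat \<Rightarrow> complex) \<Rightarrow> (complex \<Rightarrow> complex) \<Rightarrow> bool" where
  "bohr_hypotheses K f h g a b \<phi> \<longleftrightarrow>
     quasiconformal_harmonic K f h g \<and>
     (\<forall>z\<in>unit_disc. (\<lambda>n. a n * z ^ n) sums h z) \<and>
     (\<forall>z\<in>unit_disc. (\<lambda>n. b n * z ^ n) sums g z) \<and> b 0 = 0 \<and> b 1 = 0 \<and>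
     subordinate h \<phi> \<and> convex_univalent \<phi>"

definition bohr_sum :: "(nat \<Rightarrow> complex) \<Rightarrow> (nat \<Rightarrow> complex) \<Rightarrow> real \<Rightarrow> real" where
  "bohr_sum a b r =
     (\<Sum>n. norm (a (n + 1)) * r ^ (n + 1)) + (\<Sum>n. norm (b (n + 2)) * r ^ (n + 2))"

definition rc_equation :: "real \<Rightarrow> real \<Rightarrow> bool" where
  "rc_equation k r \<longleftrightarrow>
     r / (1 - r) + k * r\<^sup>2 / (1 - r\<^sup>2) * sqrt (((1 + r\<^sup>2) / (1 - r\<^sup>2)) * (pi\<^sup>2 / 6 - 1)) = 1 / 2"

definition r_c :: "real \<Rightarrow> real" where
  "r_c k = (THE r. 0 < r \<and> r < 1 \<and> rc_equation k r)"

definition R_equation :: "real \<Rightarrow> real \<Rightarrow> bool" where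
  "R_equation k R \<longleftrightarrow> 2 * (1 + k) * R / (1 - R) + 2 * k * ln (1 - R) = 1"

definition R_bound :: "real \<Rightarrow> real" where
  "R_bound k = (THE R. 0 < R \<and> R < 1 \<and> R_equation k R)"

end

(* If \<phi> maps the disc onto the convex domain S and d is the distance from \<phi>(0) to the boundary, the
   supporting line of S at a nearest boundary point confines h - h(0) to a half-plane at distance at
   most d, whence |a_n| \<le> 2 d for n \<ge> 1. As b_1 = 0, Schwarz gives |g'| \<le> k |z| |h'|, and Parseval on
   |z| = r turns this into sum n^2 |b_n|^2 r^(2n) \<le> k^2 r^2 sum n^2 |a_n|^2 r^(2n). Cauchy-Schwarz against
   sum_(n \<ge> 2) 1/n^2 = pi^2/6 - 1 then bounds the whole sum by 2 d times the left-hand side of the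
   equation for r_c. For the second radius take h = \<phi> = z/(1-z) and g' = k z h', with d = 1/2. *)

theory Submission
  imports Defs
begin

text \<open>The comparison of g' with h' is pointwise and gives no bound of a single |b_n| by |a_n|.
  It survives only in the quadratic mean over a circle, and returning from squares to first powers
  costs a Cauchy-Schwarz estimate; this is the origin of the radical in the equation for r_c. For k
  = 0 the co-analytic part is absent, both equations reduce to r/(1-r) = 1/2, and both radii are
  1/3. The dilatation k z is the natural choice for the second radius: it turns the Schwarz bound
  into an equality, and the resulting mapping has nonnegative coefficients, so its sum is simply its
  value at r.\<close>

section \<open>Fourier coefficients and Parseval's identity on circles\<close>

text \<open>The M-test makes the partial sums converge uniformly, so limit and integral commute.
  \<open>J\<close> is obtained rather than given because convergence of the series of integrals is
  part of the result; Parseval draws its summability from here.\<close>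

lemma has_integral_suminf:
  fixes f :: "nat \<Rightarrow> real \<Rightarrow> complex"
  assumes cont: "\<And>n. continuous_on {a..b} (f n)"
    and bound: "\<And>n x. x \<in> {a..b} \<Longrightarrow> norm (f n x) \<le> M n" and M: "summable M"
    and sums: "\<And>x. x \<in> {a..b} \<Longrightarrow> (\<lambda>n. f n x) sums F x"
    and int: "\<And>n. (f n has_integral I n) {a..b}"
  obtains J where "I sums J" "(F has_integral J) {a..b}"
proof -
  have "uniform_limit {a..b} (\<lambda>n x. \<Sum>i<n. f i x) (\<lambda>x. \<Sum>i. f i x) sequentially"
    by (rule Weierstrass_m_test[OF bound M])
  also have "?this \<longleftrightarrow> uniform_limit {a..b} (\<lambda>n x. \<Sum>i<n. f i x) F sequentially"
    using sums by (intro uniform_limit_cong') (auto simp: sums_iff)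
  finally have u: "uniform_limit {a..b} (\<lambda>n x. \<Sum>i<n. f i x) F sequentially" .
  obtain I' J where IJ: "\<And>n. ((\<lambda>x. \<Sum>i<n. f i x) has_integral I' n) {a..b}"
      "(F has_integral J) {a..b}" "I' \<longlonglongrightarrow> J"
    by (rule uniform_limit_integral[OF u]) (auto intro!: continuous_on_sum cont)
  have "I' n = (\<Sum>i<n. I i)" for n
    using IJ(1) by (rule has_integral_unique) (auto intro!: has_integral_sum int)
  then have "I' = (\<lambda>n. \<Sum>i<n. I i)" by auto
  then show ?thesis using IJ that by (auto simp: sums_def)
qed

lemma has_integral_cis:
  "((\<lambda>t. cis (of_int m * t)) has_integral (if m = 0 then 2 * pi else 0)) {0..2 * pi}"
proof (cases "m = 0")
  case True
  then show ?thesis using has_integral_const_real[of "1::complex" 0 "2 * pi"]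
    by (simp add: scaleR_conv_of_real)
next
  case False
  let ?G = "\<lambda>t. cis (of_int m * t) / (\<i> * of_int m)"
  have "((\<lambda>t. cis (of_int m * t)) has_integral (?G (2 * pi) - ?G 0)) {0..2 * pi}"
  proof (rule fundamental_theorem_of_calculus)
    show "(?G has_vector_derivative cis (of_int m * t)) (at t within {0..2 * pi})" for t
      using False
      by (auto intro!: derivative_eq_intros simp: has_vector_derivative_def fun_eq_iff scaleR_conv_of_real field_simps)
  qed auto
  moreover have "cis (of_int m * (2 * pi)) = 1"
    using cis_multiple_2pi[of "of_int m"] by (simp add: mult_ac)
  ultimately show ?thesis using False by simp
qed

lemma power_series_sums_cis:
  fixes c :: "nat \<Rightarrow> complex" and r t :: real
  assumes "\<And>z. z \<in> ball 0 1 \<Longrightarrow> (\<lambda>n. c n * z ^ n) sums F z" "0 \<le> r" "r < 1"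
  shows "(\<lambda>n. c n * r ^ n * cis (n * t)) sums F (r * cis t)"
proof -
  have "r * cis t \<in> ball 0 1" using assms by (simp add: norm_mult)
  from assms(1)[OF this] show ?thesis by (simp add: power_mult_distrib Complex.DeMoivre mult.assoc)
qed

lemma power_series_summable_norm:
  fixes c :: "nat \<Rightarrow> complex" and r :: real
  assumes "\<And>z. z \<in> ball 0 1 \<Longrightarrow> (\<lambda>n. c n * z ^ n) sums F z" "0 \<le> r" "r < 1"
  shows "summable (\<lambda>n. norm (c n) * r ^ n)"
proof -
  \<comment> \<open>Convergence at the point (1 + r) / 2, between r and 1, forces absolute
    convergence at r.\<close>
  have "summable (\<lambda>n. c n * complex_of_real ((1 + r) / 2) ^ n)"
    using assms(1)[of "(1 + r) / 2"] assms(2,3)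
    by (intro sums_summable[of _ "F (complex_of_real ((1 + r) / 2))"] assms(1)) (simp del: of_real_divide of_real_add)
  from powser_insidea[OF this, of r] show ?thesis using assms(2,3)
    by (simp add: norm_mult norm_power del: of_real_divide of_real_add)
qed

text \<open>Orthogonality leaves only the term of index \<open>m\<close>, and a power series has
  none for \<open>m < 0\<close>. This vanishing is what later allows F to be replaced by 2 Re
  F.\<close>

lemma fourier_coefficient:
  fixes c :: "nat \<Rightarrow> complex" and r :: real and m :: int
  assumes F: "\<And>z. z \<in> ball 0 1 \<Longrightarrow> (\<lambda>n. c n * z ^ n) sums F z" and r: "0 \<le> r" "r < 1"
  shows "((\<lambda>t. F (r * cis t) * cis (- of_int m * t)) has_integral
            (if m \<ge> 0 then 2 * pi * (c (nat m) * r ^ nat m) else 0)) {0..2 * pi}"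
proof -
  define f where "f = (\<lambda>n t. c n * r ^ n * cis (n * t) * cis (- of_int m * t))"
  define I where "I = (\<lambda>n. if int n = m then 2 * pi * (c n * r ^ n) else 0)"
  have "(f n has_integral I n) {0..2 * pi}" for n
  proof -
    have "f n = (\<lambda>t. c n * r ^ n * cis (of_int (int n - m) * t))"
      by (auto simp: f_def cis_mult algebra_simps)
    then show ?thesis
      using has_integral_mult_right[OF has_integral_cis[of "int n - m"], of "c n * r ^ n"]
      by (cases "int n = m") (simp_all add: I_def mult_ac)
  qed
  then obtain J where J: "I sums J" "((\<lambda>t. F (r * cis t) * cis (- of_int m * t)) has_integral J) {0..2 * pi}"
  proof (rule has_integral_suminf[rotated 4])
    show "norm (f n t) \<le> norm (c n) * r ^ n" for n t
      using r by (simp add: f_def norm_mult norm_power)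
    show "summable (\<lambda>n. norm (c n) * r ^ n)" by (rule power_series_summable_norm[OF F r])
    show "(\<lambda>n. f n t) sums (F (r * cis t) * cis (- of_int m * t))" for t
      unfolding f_def by (intro sums_mult2 power_series_sums_cis[OF F r])
  qed (auto simp: f_def intro!: continuous_intros)
  have "I sums (if m \<ge> 0 then 2 * pi * (c (nat m) * r ^ nat m) else 0)"
  proof (cases "m \<ge> 0")
    case True
    then have "I = (\<lambda>n. if n = nat m then 2 * pi * (c n * r ^ n) else 0)"
      by (intro ext) (auto simp: I_def)
    then show ?thesis using True sums_single[of "nat m" "\<lambda>n. 2 * pi * (c n * r ^ n)"] by simp
  next
    case False
    then have "I = (\<lambda>n. 0)" by (auto simp: I_def)
    then show ?thesis using False by simp
  qed
  with J show ?thesis using sums_unique2 by blast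
qed

lemma parseval_circle:
  fixes c :: "nat \<Rightarrow> complex" and r :: real
  assumes F: "\<And>z. z \<in> ball 0 1 \<Longrightarrow> (\<lambda>n. c n * z ^ n) sums F z" and r: "0 \<le> r" "r < 1"
  obtains S where "(\<lambda>n. 2 * pi * ((norm (c n))\<^sup>2 * r ^ (2 * n))) sums S"
    "((\<lambda>t. (norm (F (r * cis t)))\<^sup>2) has_integral S) {0..2 * pi}"
proof -
  define B where "B = (\<Sum>n. norm (c n) * r ^ n)"
  \<comment> \<open>Only the conjugate factor of |F|^2 is expanded, while F stays whole. Each term
    then integrates to a known Fourier coefficient and no double series arises; the bound
    \<open>B\<close> for |F| on the circle supplies the majorant.\<close>
  define f where "f = (\<lambda>n t. cnj (c n) * r ^ n * (F (r * cis t) * cis (- of_int (int n) * t)))"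
  have sm: "summable (\<lambda>n. norm (c n) * r ^ n)" by (rule power_series_summable_norm[OF F r])
  have "norm (F (r * cis t)) \<le> B" for t
  proof -
    have "F (r * cis t) = (\<Sum>n. c n * r ^ n * cis (n * t))"
      using power_series_sums_cis[OF F r] by (simp add: sums_iff)
    also have "norm \<dots> \<le> (\<Sum>n. norm (c n * r ^ n * cis (n * t)))"
      using sm r by (intro summable_norm) (simp add: norm_mult norm_power)
    finally show ?thesis using r by (simp add: norm_mult norm_power B_def)
  qed note B = this
  have "F holomorphic_on ball 0 1"
    by (rule power_series_holomorphic) (use F in auto)
  then have "continuous_on (ball 0 1) F" by (rule holomorphic_on_imp_continuous_on)
  then have cont: "continuous_on {0..2 * pi} (\<lambda>t. F (r * cis t))"
    by (rule continuous_on_compose2) (use r in \<open>auto intro!: continuous_intros simp: norm_mult\<close>)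
  have "(f n has_integral 2 * pi * ((norm (c n))\<^sup>2 * r ^ (2 * n))) {0..2 * pi}" for n
  proof -
    have "cnj (c n) * r ^ n * (2 * pi * (c n * r ^ n)) = complex_of_real (2 * pi * ((norm (c n))\<^sup>2 * r ^ (2 * n)))"
      unfolding mult_2 power_add of_real_mult complex_norm_square by simp
    from this[symmetric] show ?thesis unfolding f_def
      using has_integral_mult_right[OF fourier_coefficient[OF F r, of "int n"], of "cnj (c n) * r ^ n"]
      by (simp only: of_nat_0_le_iff if_True nat_int)
  qed
  then obtain J where J: "(\<lambda>n. complex_of_real (2 * pi * ((norm (c n))\<^sup>2 * r ^ (2 * n)))) sums J"
     "((\<lambda>t. complex_of_real ((norm (F (r * cis t)))\<^sup>2)) has_integral J) {0..2 * pi}"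
  proof (rule has_integral_suminf[rotated 4])
    show "norm (f n t) \<le> norm (c n) * r ^ n * B" for n t
      using r B by (simp add: f_def norm_mult norm_power mult_left_mono)
    show "summable (\<lambda>n. norm (c n) * r ^ n * B)" by (intro summable_mult2 sm)
    show "(\<lambda>n. f n t) sums complex_of_real ((norm (F (r * cis t)))\<^sup>2)" for t
    proof -
      have "(\<lambda>n. cnj (c n * r ^ n * cis (n * t))) sums cnj (F (r * cis t))"
        using power_series_sums_cis[OF F r] by (subst sums_cnj)
      then have "(\<lambda>n. F (r * cis t) * cnj (c n * r ^ n * cis (n * t))) sums (F (r * cis t) * cnj (F (r * cis t)))"
        by (rule sums_mult)
      then show ?thesis unfolding complex_norm_square by (simp add: f_def cis_cnj mult_ac)
    qed
  qed (auto simp: f_def intro!: continuous_intros cont)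
  have "(\<lambda>n. 2 * pi * ((norm (c n))\<^sup>2 * r ^ (2 * n))) sums Re J"
    using sums_Re[OF J(1)] unfolding Re_complex_of_real .
  moreover have "((\<lambda>t. (norm (F (r * cis t)))\<^sup>2) has_integral Re J) {0..2 * pi}"
    using has_integral_linear[OF J(2) bounded_linear_Re] unfolding o_def Re_complex_of_real .
  ultimately show ?thesis using that by blast
qed

text \<open>The pointwise bound is integrated over the circle. Asking for it only where |z| = r lets
  a factor |z| be absorbed into \<open>M\<close>.\<close>

lemma weighted_norm_sums_le:
  fixes b c :: "nat \<Rightarrow> complex" and r :: real
  assumes F: "\<And>z. z \<in> ball 0 1 \<Longrightarrow> (\<lambda>n. c n * z ^ n) sums F z"
    and G: "\<And>z. z \<in> ball 0 1 \<Longrightarrow> (\<lambda>n. b n * z ^ n) sums G z" and r: "0 \<le> r" "r < 1"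
    and le: "\<And>z. norm z = r \<Longrightarrow> norm (G z) \<le> M * norm (F z)"
  shows "summable (\<lambda>n. (norm (b n))\<^sup>2 * r ^ (2 * n))" "summable (\<lambda>n. (norm (c n))\<^sup>2 * r ^ (2 * n))"
    "(\<Sum>n. (norm (b n))\<^sup>2 * r ^ (2 * n)) \<le> M\<^sup>2 * (\<Sum>n. (norm (c n))\<^sup>2 * r ^ (2 * n))"
proof -
  obtain S where S: "(\<lambda>n. 2 * pi * ((norm (c n))\<^sup>2 * r ^ (2 * n))) sums S"
    "((\<lambda>t. (norm (F (r * cis t)))\<^sup>2) has_integral S) {0..2 * pi}"
    by (rule parseval_circle[OF F r])
  obtain T where T: "(\<lambda>n. 2 * pi * ((norm (b n))\<^sup>2 * r ^ (2 * n))) sums T"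
    "((\<lambda>t. (norm (G (r * cis t)))\<^sup>2) has_integral T) {0..2 * pi}"
    by (rule parseval_circle[OF G r])
  have "T \<le> M\<^sup>2 * S"
  proof (rule has_integral_le[OF T(2) has_integral_mult_right[OF S(2)]])
    show "(norm (G (r * cis t)))\<^sup>2 \<le> M\<^sup>2 * (norm (F (r * cis t)))\<^sup>2" for t
      using power_mono[OF le[of "r * cis t"], of 2] r by (simp add: norm_mult power_mult_distrib)
  qed
  moreover have s: "(\<lambda>n. (norm (c n))\<^sup>2 * r ^ (2 * n)) sums (S / (2 * pi))"
    using sums_divide[OF S(1), of "2 * pi"] by simp
  moreover have t: "(\<lambda>n. (norm (b n))\<^sup>2 * r ^ (2 * n)) sums (T / (2 * pi))"
    using sums_divide[OF T(1), of "2 * pi"] by simp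
  ultimately show "(\<Sum>n. (norm (b n))\<^sup>2 * r ^ (2 * n)) \<le> M\<^sup>2 * (\<Sum>n. (norm (c n))\<^sup>2 * r ^ (2 * n))"
    by (simp add: sums_iff divide_right_mono)
  show "summable (\<lambda>n. (norm (b n))\<^sup>2 * r ^ (2 * n))" "summable (\<lambda>n. (norm (c n))\<^sup>2 * r ^ (2 * n))"
    using s t by (auto simp: sums_iff)
qed

section \<open>Coefficient bounds for maps into half-planes and convex domains\<close>

text \<open>Caratheodory's inequality: c_n r^n is also the n-th Fourier coefficient of 2 Re F, which
  is nonnegative, so its modulus is at most the mean of 2 Re F, that is 2 Re c_0.\<close>

lemma coefficient_bound_nonneg_Re:
  fixes c :: "nat \<Rightarrow> complex"
  assumes F: "\<And>z. z \<in> ball 0 1 \<Longrightarrow> (\<lambda>n. c n * z ^ n) sums F z"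
    and Re: "\<And>z. z \<in> ball 0 1 \<Longrightarrow> Re (F z) \<ge> 0" and n: "n \<ge> 1"
  shows "norm (c n) \<le> 2 * Re (c 0)"
proof -
  have *: "norm (c n) * r ^ n \<le> 2 * Re (c 0)" if r: "0 < r" "r < 1" for r
  proof -
    have F1: "((\<lambda>t. F (r * cis t) * cis (- of_int (int n) * t)) has_integral 2 * pi * (c n * r ^ n)) {0..2 * pi}"
      using fourier_coefficient[OF F, of r "int n"] r by simp
    have F2: "((\<lambda>t. F (r * cis t) * cis (- of_int (- int n) * t)) has_integral 0) {0..2 * pi}"
      using fourier_coefficient[OF F, of r "- int n"] r n by simp
    have F3: "((\<lambda>t. F (r * cis t)) has_integral 2 * pi * c 0) {0..2 * pi}"
      using fourier_coefficient[OF F, of r 0] r by simp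
    \<comment> \<open>Conjugating the vanishing coefficient at frequency -n shows that cnj F
      contributes 0 at frequency n and may be added to F.\<close>
    have "((\<lambda>t. cnj (F (r * cis t) * cis (real n * t))) has_integral cnj 0) {0..2 * pi}"
      using has_integral_linear[OF F2 bounded_linear_cnj] by (simp add: o_def)
    from has_integral_add[OF F1 this]
    have "((\<lambda>t. complex_of_real (2 * Re (F (r * cis t))) * cis (- (n * t))) has_integral 2 * pi * (c n * r ^ n)) {0..2 * pi}"
      by (simp add: cis_cnj complex_add_cnj flip: distrib_right)
    moreover have "((\<lambda>t. 2 * Re (F (r * cis t))) has_integral 2 * Re (2 * pi * c 0)) {0..2 * pi}"
      using has_integral_mult_right[OF has_integral_linear[OF F3 bounded_linear_Re], of 2] by (simp add: o_def)
    moreover have "norm (complex_of_real (2 * Re (F (r * cis t))) * cis (- (n * t))) \<le> 2 * Re (F (r * cis t))" for t :: real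
    proof -
      have "Re (F (r * cis t)) \<ge> 0" using r by (intro Re) (simp add: norm_mult)
      then show ?thesis by (simp add: norm_mult)
    qed
    ultimately have "norm (2 * pi * (c n * r ^ n)) \<le> 2 * Re (2 * pi * c 0)"
      by (metis (no_types, lifting) integral_norm_bound_integral has_integral_iff)
    moreover have "norm (2 * pi * (c n * r ^ n)) = 2 * pi * (norm (c n) * r ^ n)"
      using r by (simp add: norm_mult norm_power)
    moreover have "2 * Re (2 * pi * c 0) = 2 * pi * (2 * Re (c 0))" by simp
    ultimately show ?thesis by (metis mult_le_cancel_left_pos pi_gt_zero mult_pos_pos zero_less_numeral)
  qed
  \<comment> \<open>Letting r tend to 1 from the left removes the factor r^n.\<close>
  have "((\<lambda>r. norm (c n) * r ^ n) \<longlongrightarrow> norm (c n) * 1 ^ n) (at_left (1::real))"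
    by (intro tendsto_intros)
  moreover have "eventually (\<lambda>r. norm (c n) * r ^ n \<le> 2 * Re (c 0)) (at_left (1::real))"
    by (rule eventually_mono[OF eventually_at_left_real[of 0 1]]) (use * in auto)
  ultimately show ?thesis
    using tendsto_upperbound by fastforce
qed

text \<open>Otherwise the inverse would be a bounded entire function, hence constant by Liouville.
  This secures a nonempty frontier; \<open>infdist\<close> to the empty set is 0 by convention, not
  a distance.\<close>

lemma univalent_image_ne_UNIV:
  assumes "\<phi> holomorphic_on ball 0 1" "inj_on \<phi> (ball 0 1)"
  shows "\<phi> ` ball 0 1 \<noteq> UNIV"
proof
  assume UNIV: "\<phi> ` ball 0 1 = UNIV"
  obtain \<psi> where \<psi>: "\<psi> holomorphic_on (\<phi> ` ball 0 1)" "\<And>z. z \<in> ball 0 1 \<Longrightarrow> \<psi> (\<phi> z) = z"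
    using holomorphic_has_inverse[OF assms(1) open_ball assms(2)] by metis
  have "\<psi> w \<in> ball 0 1" for w
    using UNIV \<psi>(2) by (metis UNIV_I imageE)
  then have "bounded (range \<psi>)"
    by (meson bounded_ball bounded_subset image_subsetI)
  then obtain c where "\<And>w. \<psi> w = c"
    using Liouville_theorem[of \<psi>] \<psi>(1) UNIV by (auto simp: constant_on_def)
  then have "z = c" if "z \<in> ball 0 1" for z using \<psi>(2)[OF that] by simp
  from this[of 0] this[of "1/2"] show False by simp
qed

text \<open>A supporting hyperplane at a nearest frontier point p suffices, whatever its direction:
  the unit outward normal u satisfies u \<bullet> (p - x) \<le> |p - x| by Cauchy-Schwarz.\<close>

lemma convex_supporting_direction:
  fixes S :: "'a::euclidean_space set"
  assumes S: "convex S" "open S" "S \<noteq> UNIV" "x \<in> S"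
  obtains u where "norm u = 1" "\<And>y. y \<in> S \<Longrightarrow> u \<bullet> (y - x) \<le> infdist x (frontier S)"
proof -
  have "frontier S \<noteq> {}" using S by (auto simp: frontier_eq_empty)
  then obtain p where p: "p \<in> frontier S" "infdist x (frontier S) = dist x p"
    using infdist_attains_inf[OF frontier_closed] by blast
  have "p \<in> closure S" "p \<notin> rel_interior S"
    using p S by (auto simp: frontier_def rel_interior_open interior_open)
  then obtain a where a: "a \<noteq> 0" "\<And>y. y \<in> closure S \<Longrightarrow> a \<bullet> p \<le> a \<bullet> y"
    using supporting_hyperplane_relative_frontier[OF S(1)] by metis
  define u where "u = - (1 / norm a) *\<^sub>R a"
  have u: "norm u = 1" using a by (simp add: u_def)
  have "u \<bullet> (y - x) \<le> infdist x (frontier S)" if y: "y \<in> S" for y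
  proof -
    have "a \<bullet> p \<le> a \<bullet> y" using a(2) y closure_subset by blast
    then have "u \<bullet> y \<le> u \<bullet> p" using a(1) by (simp add: u_def divide_right_mono)
    then have "u \<bullet> (y - x) \<le> u \<bullet> (p - x)" by (simp add: inner_diff_right)
    also have "\<dots> \<le> norm u * norm (p - x)" by (rule norm_cauchy_schwarz)
    finally show ?thesis using u p by (simp add: dist_norm norm_minus_commute)
  qed
  with u that show ?thesis by blast
qed

text \<open>The function d - cnj u (h - h(0)) has nonnegative real part and value d at 0, and since
  |u| = 1 its later coefficients have the moduli of those of h. Subordination will enter only
  through the range of h and its value at 0.\<close>

lemma coefficient_bound_convex:
  fixes a :: "nat \<Rightarrow> complex"
  assumes h: "\<And>z. z \<in> ball 0 1 \<Longrightarrow> (\<lambda>n. a n * z ^ n) sums h z"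
    and S: "convex S" "open S" "S \<noteq> UNIV" and hS: "\<And>z. z \<in> ball 0 1 \<Longrightarrow> h z \<in> S"
    and n: "n \<ge> 1"
  shows "norm (a n) \<le> 2 * infdist (h 0) (frontier S)"
proof -
  define d where "d = infdist (h 0) (frontier S)"
  obtain u where u: "norm u = 1" "\<And>y. y \<in> S \<Longrightarrow> u \<bullet> (y - h 0) \<le> d"
    using convex_supporting_direction[OF S, of "h 0"] hS unfolding d_def by auto
  define c where "c = (\<lambda>n. (if n = 0 then d + cnj u * h 0 else 0) - cnj u * a n)"
  have h0: "h 0 = a 0"
    using h[of 0] powser_sums_zero_iff[of a "h 0"] by simp
  have "norm (c n) \<le> 2 * Re (c 0)"
  proof (rule coefficient_bound_nonneg_Re[OF _ _ n])
    fix z :: complex assume z: "z \<in> ball 0 1"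
    have "(\<lambda>n. (if n = 0 then (d + cnj u * h 0) * z ^ n else 0)) sums ((d + cnj u * h 0) * z ^ 0)"
      by (rule sums_single)
    from sums_diff[OF this sums_mult[OF h[OF z], of "cnj u"]]
    have "(\<lambda>n. (if n = 0 then (d + cnj u * h 0) * z ^ n else 0) - cnj u * (a n * z ^ n)) sums
        (d - cnj u * (h z - h 0))" by (simp add: algebra_simps)
    also have "(\<lambda>n. (if n = 0 then (d + cnj u * h 0) * z ^ n else 0) - cnj u * (a n * z ^ n)) =
        (\<lambda>n. c n * z ^ n)"
      by (auto simp: c_def algebra_simps)
    finally show "(\<lambda>n. c n * z ^ n) sums (d - cnj u * (h z - h 0))" .
    show "Re (d - cnj u * (h z - h 0)) \<ge> 0"
      using u(2)[OF hS[OF z]] by (simp add: inner_complex_def)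
  qed
  also have "norm (c n) = norm (a n)" using n u by (simp add: c_def norm_mult)
  also have "c 0 = d" by (simp add: c_def h0)
  finally show ?thesis by (simp add: d_def)
qed

section \<open>Auxiliary series and a form of Schwarz's lemma\<close>

text \<open>Using z f' in place of f' keeps index and exponent equal, so coefficients become n c_n
  without a shift.\<close>

lemma sums_mult_deriv:
  fixes z :: "'a :: {banach,real_normed_field}"
  assumes "\<And>z. norm z < 1 \<Longrightarrow> (\<lambda>n. c n * z ^ n) sums f z"
    and "(f has_field_derivative f') (at z)" and "norm z < 1"
  shows "(\<lambda>n. of_nat n * c n * z ^ n) sums (z * f')"
proof -
  have "(\<lambda>n. z * (diffs c n * z ^ n)) sums (z * f')"
    by (intro sums_mult termdiffs_sums_strong[OF assms])
  then have "(\<lambda>n. of_nat (Suc n) * c (Suc n) * z ^ Suc n) sums (z * f')"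
    by (simp add: diffs_def mult_ac)
  then show ?thesis by (subst (asm) sums_Suc_iff) simp
qed

text \<open>The operator z d/dz is applied twice to the geometric series.\<close>

lemma square_geometric_sums:
  fixes x :: real
  assumes x: "\<bar>x\<bar> < 1"
  shows "(\<lambda>n. (real n)\<^sup>2 * x ^ n) sums (x * (1 + x) / (1 - x) ^ 3)"
proof -
  have 1: "(\<lambda>n. real n * 1 * y ^ n) sums (y * (1 / (1 - y)\<^sup>2))" if "norm y < 1" for y :: real
    using that
    by (intro sums_mult_deriv[where f = "\<lambda>y. 1 / (1 - y)"])
       (auto simp: geometric_sums power2_eq_square intro!: derivative_eq_intros)
  have "((\<lambda>y. y * (1 / (1 - y)\<^sup>2)) has_field_derivative ((1 + x) / (1 - x) ^ 3)) (at x)"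
    using x by (auto intro!: derivative_eq_intros simp: divide_simps)
       (simp add: algebra_simps power2_eq_square power3_eq_cube power4_eq_xxxx)
  from sums_mult_deriv[OF 1 this] x show ?thesis by (simp add: power2_eq_square mult.assoc)
qed

lemma inverse_squares_from_2_sums: "(\<lambda>n. 1 / (real (n + 2))\<^sup>2) sums (pi\<^sup>2 / 6 - 1)"
  using inverse_squares_sums sums_Suc_iff[of "\<lambda>n. 1 / (real n + 1)\<^sup>2" "pi\<^sup>2 / 6 - 1"]
  by (simp add: add_ac)

lemma pi_squared_ge: "pi\<^sup>2 / 6 - 1 \<ge> 0"
  by (rule sums_le[OF _ sums_zero inverse_squares_from_2_sums]) simp

text \<open>Schwarz's lemma wants a strict bound by 1, whereas here the bound is not strict and k
  may be 0. Dividing by some l > k and letting l decrease to k handles both.\<close>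

lemma Schwarz_bound:
  assumes hol: "\<omega> holomorphic_on ball 0 1" and "\<omega> 0 = 0"
    and le: "\<And>z. z \<in> ball 0 1 \<Longrightarrow> norm (\<omega> z) \<le> k" and z: "z \<in> ball 0 1"
  shows "norm (\<omega> z) \<le> k * norm z"
proof -
  have k: "k \<ge> 0" using le[of 0] norm_ge_zero[of "\<omega> 0"] by (simp del: norm_ge_zero add: assms(2))
  have *: "norm (\<omega> z) \<le> l * norm z" if l: "l > k" for l
  proof -
    have "norm (\<omega> z / l) \<le> norm z"
    proof (rule Schwarz_Lemma(1))
      show "(\<lambda>z. \<omega> z / l) holomorphic_on ball 0 1"
        using k l by (intro holomorphic_intros hol) auto
      show "norm (\<omega> z / l) < 1" if "norm z < 1" for z
        using le[of z] that k l by (simp add: norm_divide divide_simps)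
    qed (use z assms in auto)
    then show ?thesis using k l by (simp add: norm_divide divide_simps mult_ac)
  qed
  have "((\<lambda>l. l * norm z) \<longlongrightarrow> k * norm z) (at_right k)" by (intro tendsto_intros)
  moreover have "eventually (\<lambda>l. norm (\<omega> z) \<le> l * norm z) (at_right k)"
    using eventually_at_right_less[of k] by eventually_elim (rule *)
  ultimately show ?thesis using tendsto_lowerbound by fastforce
qed

section \<open>The sum over the co-analytic coefficients\<close>

text \<open>With |a_n| \<le> C the sum of n^2 |a_n|^2 r^(2n) is at most C^2 r^2 (1 + r^2) / (1 -
  r^2)^3. Multiplying by (k r)^2 and by pi^2/6 - 1 and taking the root gives the right-hand
  side.\<close>

lemma coanalytic_sum_bound:
  fixes a b :: "nat \<Rightarrow> complex"
  assumes h: "\<And>z. z \<in> ball 0 1 \<Longrightarrow> (\<lambda>n. a n * z ^ n) sums h z"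
    and g: "\<And>z. z \<in> ball 0 1 \<Longrightarrow> (\<lambda>n. b n * z ^ n) sums g z"
    and hol: "h holomorphic_on ball 0 1" "g holomorphic_on ball 0 1"
    and dil: "\<And>z. z \<in> ball 0 1 \<Longrightarrow> norm (deriv g z) \<le> k * norm z * norm (deriv h z)"
    and a: "\<And>n. n \<ge> 1 \<Longrightarrow> norm (a n) \<le> C" and k: "k \<ge> 0" and r: "0 \<le> r" "r < 1"
  shows "(\<Sum>n. norm (b (n + 2)) * r ^ (n + 2)) \<le>
    C * (k * r\<^sup>2 / (1 - r\<^sup>2) * sqrt (((1 + r\<^sup>2) / (1 - r\<^sup>2)) * (pi\<^sup>2 / 6 - 1)))"
proof -
  have C: "C \<ge> 0" using a[of 1] norm_ge_zero[of "a 1"] by linarith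
  have r2: "0 \<le> r\<^sup>2" "r\<^sup>2 < 1" using r by (auto simp: power_less_one_iff)
  have series: "(\<lambda>n. of_nat n * c n * z ^ n) sums (z * deriv f z)"
    if "\<And>z. z \<in> ball 0 1 \<Longrightarrow> (\<lambda>n. c n * z ^ n) sums f z" "f holomorphic_on ball 0 1" "z \<in> ball 0 1"
    for c :: "nat \<Rightarrow> complex" and f z
    using that by (intro sums_mult_deriv[OF _ holomorphic_derivI[OF that(2) open_ball that(3)]]) auto
  have le: "norm (z * deriv g z) \<le> (k * r) * norm (z * deriv h z)" if "norm z = r" for z
    using mult_left_mono[OF dil[of z] norm_ge_zero[of z]] that r by (simp add: norm_mult mult_ac)
  define x where "x = (\<lambda>n. (norm (of_nat n * b n))\<^sup>2 * r ^ (2 * n))"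
  \<comment> \<open>Parseval is used for z h' and z g', whose coefficients are n a_n and n b_n, with
    \<open>M\<close> = k r.\<close>
  note w = weighted_norm_sums_le[OF series[OF h hol(1)] series[OF g hol(2)] r le]
  have sx: "summable x" using w(1) by (simp add: x_def)
  have q: "(\<lambda>n. C\<^sup>2 * ((real n)\<^sup>2 * (r\<^sup>2) ^ n)) sums (C\<^sup>2 * (r\<^sup>2 * (1 + r\<^sup>2) / (1 - r\<^sup>2) ^ 3))"
    using r2 by (intro sums_mult square_geometric_sums) auto
  have "suminf x \<le> (k * r)\<^sup>2 * (\<Sum>n. (norm (of_nat n * a n))\<^sup>2 * r ^ (2 * n))"
    using w(3) by (simp add: x_def)
  also have "(\<Sum>n. (norm (of_nat n * a n))\<^sup>2 * r ^ (2 * n)) \<le> (\<Sum>n. C\<^sup>2 * ((real n)\<^sup>2 * (r\<^sup>2) ^ n))"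
  proof (rule suminf_le)
    show "(norm (of_nat n * a n))\<^sup>2 * r ^ (2 * n) \<le> C\<^sup>2 * ((real n)\<^sup>2 * (r\<^sup>2) ^ n)" for n
    \<comment> \<open>The bound by C does not cover a_0, but the factor n removes that term.\<close>
    proof (cases "n = 0")
      case False
      then have "(norm (a n))\<^sup>2 \<le> C\<^sup>2" using a[of n] by (intro power_mono) auto
      then have "((real n)\<^sup>2 * r ^ (2 * n)) * (norm (a n))\<^sup>2 \<le> ((real n)\<^sup>2 * r ^ (2 * n)) * C\<^sup>2"
        using r by (intro mult_left_mono) auto
      then show ?thesis by (simp add: norm_mult power_mult_distrib mult_ac flip: power_mult)
    qed auto
  qed (use w(2) q in \<open>auto simp: sums_iff\<close>)
  also have "\<dots> = C\<^sup>2 * (r\<^sup>2 * (1 + r\<^sup>2) / (1 - r\<^sup>2) ^ 3)" using q by (simp add: sums_iff)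
  finally have X: "suminf x \<le> (k * r)\<^sup>2 * (C\<^sup>2 * (r\<^sup>2 * (1 + r\<^sup>2) / (1 - r\<^sup>2) ^ 3))"
    by (simp add: mult_left_mono)
  let ?D = "C * (k * r\<^sup>2 / (1 - r\<^sup>2) * sqrt (((1 + r\<^sup>2) / (1 - r\<^sup>2)) * (pi\<^sup>2 / 6 - 1)))"
  have D: "?D\<^sup>2 = ((k * r)\<^sup>2 * (C\<^sup>2 * (r\<^sup>2 * (1 + r\<^sup>2) / (1 - r\<^sup>2) ^ 3))) * (pi\<^sup>2 / 6 - 1)"
  proof -
    have "(sqrt (((1 + r\<^sup>2) / (1 - r\<^sup>2)) * (pi\<^sup>2 / 6 - 1)))\<^sup>2 = ((1 + r\<^sup>2) / (1 - r\<^sup>2)) * (pi\<^sup>2 / 6 - 1)"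
      using r2 pi_squared_ge by (intro real_sqrt_pow2 mult_nonneg_nonneg) auto
    then show ?thesis unfolding power_mult_distrib power_divide
      by (simp add: power2_eq_square power3_eq_cube)
  qed
  show ?thesis
  proof (rule suminf_le_const)
    have s: "summable (\<lambda>n. norm (b n) * r ^ n)" by (rule power_series_summable_norm[OF g r])
    show "summable (\<lambda>n. norm (b (n + 2)) * r ^ (n + 2))" using summable_ignore_initial_segment[OF s] .
    fix N
    \<comment> \<open>Each term is split as (n |b_n| r^n) (1/n) with index at least 2, and
      Cauchy-Schwarz is applied to partial sums.\<close>
    have "(\<Sum>n<N. norm (b (n + 2)) * r ^ (n + 2))\<^sup>2 =
        (\<Sum>n<N. (norm (of_nat (n + 2) * b (n + 2)) * r ^ (n + 2)) * (1 / real (n + 2)))\<^sup>2"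
      by (intro arg_cong[where f = "\<lambda>x. x\<^sup>2"] sum.cong refl)
         (simp add: norm_mult norm_of_nat del: of_nat_add of_nat_Suc add_2_eq_Suc')
    also have "\<dots> \<le> (\<Sum>n<N. (norm (of_nat (n + 2) * b (n + 2)) * r ^ (n + 2))\<^sup>2) * (\<Sum>n<N. (1 / real (n + 2))\<^sup>2)"
      by (rule Cauchy_Schwarz_ineq_sum)
    also have "\<dots> \<le> suminf x * (pi\<^sup>2 / 6 - 1)"
    proof (rule mult_mono)
      have "(\<Sum>n<N. (norm (of_nat (n + 2) * b (n + 2)) * r ^ (n + 2))\<^sup>2) = (\<Sum>n<N. x (n + 2))"
        unfolding x_def by (simp only: power_mult_distrib power_even_eq)
      also have "\<dots> \<le> (\<Sum>n. x (n + 2))"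
        using summable_ignore_initial_segment[OF sx, of 2] r
        by (intro sum_le_suminf) (auto simp: x_def)
      also have "\<dots> \<le> suminf x"
        using suminf_split_initial_segment[OF sx, of 2] r by (simp add: x_def sum_nonneg)
      finally show "(\<Sum>n<N. (norm (of_nat (n + 2) * b (n + 2)) * r ^ (n + 2))\<^sup>2) \<le> suminf x" .
      show "0 \<le> suminf x" using sx r by (intro suminf_nonneg) (auto simp: x_def)
      show "(\<Sum>n<N. (1 / real (n + 2))\<^sup>2) \<le> pi\<^sup>2 / 6 - 1"
        using inverse_squares_from_2_sums sum_le_suminf[of "\<lambda>n. 1 / (real (n + 2))\<^sup>2" "{..<N}"]
        by (simp add: sums_iff power_divide)
    qed (auto intro: sum_nonneg)
    also have "\<dots> \<le> ?D\<^sup>2"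
      unfolding D by (intro mult_right_mono X pi_squared_ge)
    finally show "(\<Sum>n<N. norm (b (n + 2)) * r ^ (n + 2)) \<le> ?D"
    proof (rule power2_le_imp_le)
      show "0 \<le> ?D" using C k r2 pi_squared_ge by (intro mult_nonneg_nonneg divide_nonneg_nonneg) auto
    qed
  qed
qed

section \<open>Existence and uniqueness of the two radii\<close>

text \<open>The endpoint 1/3 is where r/(1-r) = 1/2. Both left-hand sides have reached their target
  there, so the singularity at 1 is avoided.\<close>

lemma ex1_root_unit_interval:
  fixes f :: "real \<Rightarrow> real"
  assumes mono: "\<And>x y. 0 \<le> x \<Longrightarrow> x < y \<Longrightarrow> y < 1 \<Longrightarrow> f x < f y"
    and cont: "continuous_on {0..1/3} f" and "f 0 < c" "c \<le> f (1/3)"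
  shows "\<exists>!x. 0 < x \<and> x < 1 \<and> f x = c"
proof -
  obtain x where "0 \<le> x" "x \<le> 1/3" "f x = c"
    using IVT'[of f 0 c "1/3"] assms by auto
  moreover have "x \<noteq> 0" using assms(3) \<open>f x = c\<close> by auto
  ultimately have "0 < x \<and> x < 1 \<and> f x = c" by auto
  then show ?thesis
  proof (rule ex1I)
    fix y assume "0 < y \<and> y < 1 \<and> f y = c"
    then show "y = x"
      using mono[of x y] mono[of y x] \<open>0 < x \<and> x < 1 \<and> f x = c\<close> by (cases x y rule: linorder_cases) auto
  qed
qed

definition rc_lhs :: "real \<Rightarrow> real \<Rightarrow> real" where
  "rc_lhs k r = r / (1 - r) + k * r\<^sup>2 / (1 - r\<^sup>2) * sqrt (((1 + r\<^sup>2) / (1 - r\<^sup>2)) * (pi\<^sup>2 / 6 - 1))"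

definition R_lhs :: "real \<Rightarrow> real \<Rightarrow> real" where
  "R_lhs k R = 2 * (1 + k) * R / (1 - R) + 2 * k * ln (1 - R)"

text \<open>Strictness comes from r/(1-r) alone; the other term is merely nondecreasing and vanishes
  for k = 0.\<close>

lemma rc_lhs_strict_mono:
  assumes k: "0 \<le> k" and r: "0 \<le> r" "r < s" "s < 1"
  shows "rc_lhs k r < rc_lhs k s"
proof -
  have sq: "r\<^sup>2 \<le> s\<^sup>2" "s\<^sup>2 < 1" using r by (auto intro: power_mono simp: power_less_one_iff)
  have "r / (1 - r) < s / (1 - s)" using r by (simp add: divide_simps algebra_simps)
  moreover have "k * r\<^sup>2 / (1 - r\<^sup>2) \<le> k * s\<^sup>2 / (1 - s\<^sup>2)"
    using sq k by (intro frac_le mult_left_mono) auto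
  moreover have "sqrt (((1 + r\<^sup>2) / (1 - r\<^sup>2)) * (pi\<^sup>2 / 6 - 1)) \<le> sqrt (((1 + s\<^sup>2) / (1 - s\<^sup>2)) * (pi\<^sup>2 / 6 - 1))"
    using sq pi_squared_ge by (intro real_sqrt_le_mono mult_right_mono frac_le) auto
  ultimately show ?thesis unfolding rc_lhs_def
    using sq k pi_squared_ge by (intro add_less_le_mono mult_mono) auto
qed

text \<open>The logarithmic term decreases, so it has to be weighed against the first. In u =
  1/(1-R) the expression is 2 (1+k) (u-1) - 2 k ln u, and on u \<ge> 1 the logarithm grows no faster
  than u.\<close>

lemma R_lhs_strict_mono:
  assumes k: "0 \<le> k" and r: "0 \<le> r" "r < s" "s < 1"
  shows "R_lhs k r < R_lhs k s"
proof -
  have lhs: "R_lhs k x = 2 * (1 + k) * (1 / (1 - x) - 1) - 2 * k * ln (1 / (1 - x))" if "x < 1" for x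
  proof -
    have "1 / (1 - x) - 1 = x / (1 - x)" using that by (simp add: divide_simps)
    moreover have "ln (1 / (1 - x)) = - ln (1 - x)" using that by (simp add: ln_div)
    ultimately show ?thesis by (simp add: R_lhs_def)
  qed
  define u v where "u = 1 / (1 - r)" and "v = 1 / (1 - s)"
  have uv: "1 \<le> u" "u < v" using r by (auto simp: u_def v_def divide_simps)
  have "ln v - ln u \<le> (v - u) / u" using uv by (intro ln_diff_le) auto
  also have "\<dots> \<le> (v - u) / 1" using uv by (intro divide_left_mono) auto
  finally have "k * (ln v - ln u) \<le> k * (v - u)" using k by (intro mult_left_mono) auto
  then have "2 * (1 + k) * (u - 1) - 2 * k * ln u < 2 * (1 + k) * (v - 1) - 2 * k * ln v"
    using uv by (simp add: algebra_simps)
  then show ?thesis using lhs[of r] lhs[of s] r by (simp add: u_def v_def)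
qed

lemma rc_equation_ex1:
  assumes k: "0 \<le> k"
  shows "\<exists>!r. 0 < r \<and> r < 1 \<and> rc_equation k r"
proof -
  have "\<exists>!r. 0 < r \<and> r < 1 \<and> rc_lhs k r = 1 / 2"
  proof (rule ex1_root_unit_interval)
    show "continuous_on {0..1/3} (rc_lhs k)" unfolding rc_lhs_def
      by (intro continuous_intros) (auto simp: power2_eq_1_iff)
    have "0 \<le> k * (1/3)\<^sup>2 / (1 - (1/3)\<^sup>2) * sqrt (((1 + (1/3)\<^sup>2) / (1 - (1/3)\<^sup>2)) * (pi\<^sup>2 / 6 - 1))"
      using k pi_squared_ge by (intro mult_nonneg_nonneg) (auto simp: power2_eq_square)
    then show "1 / 2 \<le> rc_lhs k (1/3)" unfolding rc_lhs_def by simp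
  qed (use rc_lhs_strict_mono[OF k] in \<open>auto simp: rc_lhs_def\<close>)
  then show ?thesis by (simp add: rc_equation_def rc_lhs_def)
qed

lemma R_equation_ex1:
  assumes k: "0 \<le> k"
  shows "\<exists>!r. 0 < r \<and> r < 1 \<and> R_equation k r"
proof -
  have "\<exists>!r. 0 < r \<and> r < 1 \<and> R_lhs k r = 1"
  proof (rule ex1_root_unit_interval)
    show "continuous_on {0..1/3} (R_lhs k)" unfolding R_lhs_def
      by (intro continuous_intros) auto
    \<comment> \<open>The value at 1/3 is 1 + k - 2 k ln(3/2), which is at least 1 by this
      estimate.\<close>
    have "ln (3 / 2 :: real) \<le> 1 / 2" using ln_le_minus_one[of "3/2::real"] by simp
    then have "- (1 / 2) \<le> ln (2 / 3 :: real)" by (simp add: ln_div)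
    from mult_left_mono[OF this, of "2 * k"] k
    show "1 \<le> R_lhs k (1/3)" by (simp add: R_lhs_def add_divide_distrib)
  qed (use R_lhs_strict_mono[OF k] in \<open>auto simp: R_lhs_def\<close>)
  then show ?thesis by (simp add: R_equation_def R_lhs_def)
qed

section \<open>The Bohr inequality up to r_c\<close>

lemma bohr_inequality:
  assumes hyp: "bohr_hypotheses K f h g a b \<phi>" and k: "k = (K - 1) / (K + 1)"
    and r: "0 \<le> r" "r < 1" "rc_lhs k r \<le> 1 / 2"
  shows "summable (\<lambda>n. norm (a (n + 1)) * r ^ (n + 1))"
    "summable (\<lambda>n. norm (b (n + 2)) * r ^ (n + 2))"
    "bohr_sum a b r \<le> infdist (\<phi> 0) (frontier (\<phi> ` unit_disc))"
proof -
  have h: "\<And>z. z \<in> ball 0 1 \<Longrightarrow> (\<lambda>n. a n * z ^ n) sums h z"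
    and g: "\<And>z. z \<in> ball 0 1 \<Longrightarrow> (\<lambda>n. b n * z ^ n) sums g z" and b: "b 0 = 0" "b 1 = 0"
    and \<phi>: "\<phi> holomorphic_on ball 0 1" "inj_on \<phi> (ball 0 1)" "convex (\<phi> ` ball 0 1)"
    and sub: "subordinate h \<phi>" and qc: "quasiconformal_harmonic K f h g"
    using hyp by (auto simp: bohr_hypotheses_def convex_univalent_def)
  have hol: "h holomorphic_on ball 0 1" "g holomorphic_on ball 0 1"
    using qc by (auto simp: quasiconformal_harmonic_def canonical_decomposition_def)
  \<comment> \<open>Sense preservation excludes zeros of h', so the dilatation g'/h' is holomorphic
    on the disc.\<close>
  have sp: "deriv h z \<noteq> 0" if "z \<in> ball 0 1" for z
  proof
    assume "deriv h z = 0"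
    moreover have "(norm (deriv h z))\<^sup>2 - (norm (deriv g z))\<^sup>2 > 0"
      using qc that by (auto simp: quasiconformal_harmonic_def sense_preserving_def)
    ultimately show False by simp
  qed
  obtain k' where k': "0 \<le> k'" "k' < 1" "K = (1 + k') / (1 - k')"
    "\<And>z. z \<in> ball 0 1 \<Longrightarrow> norm (deriv g z / deriv h z) \<le> k'"
    using qc by (auto simp: quasiconformal_harmonic_def)
  \<comment> \<open>The definition only asserts some dilatation bound, but K determines it.\<close>
  have "k = k'"
    unfolding k k'(3) using k'(1,2) by (simp add: divide_simps)
  note k' = k'(1,2) k'(4)[folded \<open>k = k'\<close>]
  have k0: "0 \<le> k" using k' \<open>k = k'\<close> by simp
  let ?d = "infdist (\<phi> 0) (frontier (\<phi> ` unit_disc))"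
  have h0: "h 0 = \<phi> 0" using sub by (simp add: subordinate_def)
  have "h z \<in> \<phi> ` ball 0 1" if "z \<in> ball 0 1" for z
    using sub that unfolding subordinate_def by force
  then have A: "norm (a n) \<le> 2 * ?d" if "n \<ge> 1" for n
    using coefficient_bound_convex[OF h \<phi>(3) open_mapping_thm3[OF \<phi>(1) open_ball \<phi>(2)] univalent_image_ne_UNIV[OF \<phi>(1,2)]] that h0
    by simp
  \<comment> \<open>Here b_1 = 0 enters: it makes the dilatation vanish at 0, as Schwarz's lemma
    requires.\<close>
  have dg0: "deriv g 0 = 0"
  proof -
    have "(\<lambda>n. diffs b n * 0 ^ n) sums deriv g 0"
      using g holomorphic_derivI[OF hol(2) open_ball, of 0]
      by (intro termdiffs_sums_strong[where f = g and K = 1]) auto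
    then show ?thesis using b by (simp add: diffs_def)
  qed
  have dil: "norm (deriv g z) \<le> k * norm z * norm (deriv h z)" if z: "z \<in> ball 0 1" for z
  proof -
    have "norm (deriv g z / deriv h z) \<le> k * norm z"
      using k'(3) sp dg0 z hol
      by (intro Schwarz_bound[where \<omega> = "\<lambda>z. deriv g z / deriv h z"] holomorphic_on_divide holomorphic_deriv) auto
    then show ?thesis using sp[OF z] by (simp add: norm_divide divide_simps)
  qed
  have sa: "summable (\<lambda>n. norm (a n) * r ^ n)" by (rule power_series_summable_norm[OF h r(1,2)])
  have sb: "summable (\<lambda>n. norm (b n) * r ^ n)" by (rule power_series_summable_norm[OF g r(1,2)])
  show sa': "summable (\<lambda>n. norm (a (n + 1)) * r ^ (n + 1))"
    by (rule summable_ignore_initial_segment[OF sa])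
  show "summable (\<lambda>n. norm (b (n + 2)) * r ^ (n + 2))"
    by (rule summable_ignore_initial_segment[OF sb])
  have geo: "(\<lambda>n. 2 * ?d * r * r ^ n) sums (2 * ?d * r * (1 / (1 - r)))"
    using r by (intro sums_mult geometric_sums) auto
  have "(\<Sum>n. norm (a (n + 1)) * r ^ (n + 1)) \<le> (\<Sum>n. 2 * ?d * r * r ^ n)"
  proof (rule suminf_le[OF _ sa' sums_summable[OF geo]])
    show "norm (a (n + 1)) * r ^ (n + 1) \<le> 2 * ?d * r * r ^ n" for n
      using mult_right_mono[OF A[of "n + 1"], of "r ^ (n + 1)"] r by (simp add: mult_ac)
  qed
  also have "\<dots> = 2 * ?d * (r / (1 - r))" using geo by (simp add: sums_iff)
  finally have "bohr_sum a b r \<le> 2 * ?d * rc_lhs k r"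
    using coanalytic_sum_bound[OF h g hol dil A k0 r(1,2)]
    unfolding bohr_sum_def rc_lhs_def distrib_left by linarith
  also have "\<dots> \<le> 2 * ?d * (1 / 2)"
    using r(3) infdist_nonneg by (intro mult_left_mono) auto
  finally show "bohr_sum a b r \<le> ?d" by simp
qed

section \<open>Harmonicity of h + cnj g\<close>

text \<open>The first-order partials of Re f are Re f' and -Im f'. Treating both Re and -Im lets the
  same facts, applied to f', yield all second-order partials.\<close>

lemma has_derivative_Re_Im_holomorphic:
  assumes "f holomorphic_on S" "open S" "z \<in> S"
  shows "((\<lambda>z. Re (f z)) has_derivative (\<lambda>v. Re v * Re (deriv f z) + Im v * - Im (deriv f z))) (at z)"
    and "((\<lambda>z. - Im (f z)) has_derivative (\<lambda>v. Re v * - Im (deriv f z) + Im v * - Re (deriv f z))) (at z)"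
proof -
  have f: "(f has_derivative (\<lambda>v. deriv f z * v)) (at z)"
    using holomorphic_derivI[OF assms] by (simp add: has_field_derivative_def)
  show "((\<lambda>z. Re (f z)) has_derivative (\<lambda>v. Re v * Re (deriv f z) + Im v * - Im (deriv f z))) (at z)"
    using has_derivative_Re[OF f] by (simp add: algebra_simps)
  show "((\<lambda>z. - Im (f z)) has_derivative (\<lambda>v. Re v * - Im (deriv f z) + Im v * - Re (deriv f z))) (at z)"
    using has_derivative_minus[OF has_derivative_Im[OF f]] by (simp add: algebra_simps)
qed

lemma harmonic_on_Re:
  assumes f: "f holomorphic_on S" and S: "open S"
  shows "harmonic_on (\<lambda>z. Re (f z)) S"
proof -
  have f': "deriv f holomorphic_on S" and f'': "deriv (deriv f) holomorphic_on S"
    using f S by (auto intro!: holomorphic_deriv)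
  note c = holomorphic_on_imp_continuous_on[OF f'']
  show ?thesis
    unfolding harmonic_on_def
    by (intro conjI S exI[of _ "\<lambda>z. Re (deriv f z)"] exI[of _ "\<lambda>z. - Im (deriv f z)"]
          exI[of _ "\<lambda>z. Re (deriv (deriv f) z)"] exI[of _ "\<lambda>z. - Im (deriv (deriv f) z)"]
          exI[of _ "\<lambda>z. - Re (deriv (deriv f) z)"] ballI
          has_derivative_Re_Im_holomorphic[OF f S] has_derivative_Re_Im_holomorphic[OF f' S]
          continuous_intros c) auto
qed

text \<open>Both parts are real parts of holomorphic functions: Re (h + cnj g) = Re (h + g) and Im
  (h + cnj g) = Re (-i (h - g)).\<close>

lemma harmonic_mapping_add_cnj:
  assumes h: "h holomorphic_on ball 0 1" and g: "g holomorphic_on ball 0 1"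
  shows "harmonic_mapping (\<lambda>z. h z + cnj (g z))"
proof -
  have "harmonic_on (\<lambda>z. Re (h z + g z)) (ball 0 1)"
    by (intro harmonic_on_Re holomorphic_intros assms open_ball)
  moreover have "harmonic_on (\<lambda>z. Re (- \<i> * (h z - g z))) (ball 0 1)"
    by (intro harmonic_on_Re holomorphic_intros assms open_ball)
  ultimately show ?thesis by (simp add: harmonic_mapping_def)
qed

section \<open>The half-plane map and the extremal harmonic mapping\<close>

text \<open>The line Re w = -1/2 is the perpendicular bisector of 0 and -1. With the inverse w/(1+w)
  of z/(1-z) this identifies the image of the disc.\<close>

lemma norm_less_norm_1_plus_iff: "norm w < norm (1 + w) \<longleftrightarrow> - 1 / 2 < Re w"
proof -
  have "norm w < norm (1 + w) \<longleftrightarrow> (norm w)\<^sup>2 < (norm (1 + w))\<^sup>2"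
    using power_strict_mono[of "norm w" "norm (1 + w)" 2] power2_less_imp_less[of "norm w" "norm (1 + w)"] by auto
  also have "\<dots> \<longleftrightarrow> - 1 / 2 < Re w"
    unfolding cmod_power2 by (simp add: power2_eq_square algebra_simps) linarith
  finally show ?thesis .
qed

lemma halfplane_map_image: "(\<lambda>z::complex. z / (1 - z)) ` ball 0 1 = {w. - 1 / 2 < Re w}"
proof (intro equalityI subsetI)
  fix w :: complex assume "w \<in> (\<lambda>z. z / (1 - z)) ` ball 0 1"
  then obtain z where z: "norm z < 1" "w = z / (1 - z)" by auto
  have "1 - z \<noteq> 0" using z(1) by auto
  then have "1 + w = 1 / (1 - z)" unfolding z(2) by (simp add: field_simps)
  then have "norm w < norm (1 + w)"
    using z \<open>1 - z \<noteq> 0\<close> by (simp add: norm_divide divide_strict_right_mono)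
  then show "w \<in> {w. - 1 / 2 < Re w}" using norm_less_norm_1_plus_iff by simp
next
  fix w :: complex assume "w \<in> {w. - 1 / 2 < Re w}"
  then have w: "norm w < norm (1 + w)" using norm_less_norm_1_plus_iff by simp
  then have "1 + w \<noteq> 0" by auto
  then have "w = (w / (1 + w)) / (1 - w / (1 + w))" by (simp add: divide_simps)
  moreover have "w / (1 + w) \<in> ball 0 1" using w \<open>1 + w \<noteq> 0\<close> by (simp add: norm_divide)
  ultimately show "w \<in> (\<lambda>z. z / (1 - z)) ` ball 0 1" by (rule image_eqI)
qed

lemma halfplane_map_inj: "inj_on (\<lambda>z::complex. z / (1 - z)) (ball 0 1)"
proof (rule inj_onI)
  fix x y :: complex assume "x \<in> ball 0 1" "y \<in> ball 0 1" and e: "x / (1 - x) = y / (1 - y)"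
  then have "1 - x \<noteq> 0" "1 - y \<noteq> 0" by auto
  with e show "x = y" by (simp add: frac_eq_eq algebra_simps)
qed

text \<open>In the coordinate \<open>w = z / (1 - z)\<close> the co-analytic part is a \<open>k\<close>-contraction on a half-plane,
  so it cannot undo the injectivity of the identity.\<close>

lemma extremal_map_inj:
  fixes k :: real
  assumes k: "0 \<le> k" "k < 1"
  shows "inj_on (\<lambda>z. z / (1 - z) + cnj (k * (z / (1 - z) + Ln (1 - z)))) (ball 0 1)"
proof (rule inj_onI)
  define H where "H = {w::complex. - 1 / 2 < Re w}"
  \<comment> \<open>This is g in the coordinate w: from 1 + w = 1/(1-z) one gets Ln (1-z) = -Ln
    (1+w). Its derivative k w/(1+w) has modulus at most k on \<open>H\<close>.\<close>
  define G where "G = (\<lambda>w::complex. k * (w - Ln (1 + w)))"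
  fix x y :: complex
  assume xy: "x \<in> ball 0 1" "y \<in> ball 0 1"
    and e: "x / (1 - x) + cnj (k * (x / (1 - x) + Ln (1 - x))) =
            y / (1 - y) + cnj (k * (y / (1 - y) + Ln (1 - y)))"
  have G: "k * (z / (1 - z) + Ln (1 - z)) = G (z / (1 - z))" if "z \<in> ball 0 1" for z
  proof -
    have "Re z < 1" using that complex_Re_le_cmod[of z] by simp
    then have "1 - z \<noteq> 0" "1 - z \<notin> \<real>\<^sub>\<le>\<^sub>0"
      by (auto simp: complex_nonpos_Reals_iff)
    then have "1 + z / (1 - z) = inverse (1 - z)" "Ln (inverse (1 - z)) = - Ln (1 - z)"
      by (simp_all add: divide_simps Ln_inverse del: inverse_eq_divide)
    then show ?thesis by (simp add: G_def)
  qed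
  have H: "z / (1 - z) \<in> H" if "z \<in> ball 0 1" for z
    using that halfplane_map_image unfolding H_def by blast
  have "norm (G (x / (1 - x)) - G (y / (1 - y))) \<le> k * norm (x / (1 - x) - y / (1 - y))"
  proof (rule field_differentiable_bound)
    show "convex H" unfolding H_def by (rule convex_halfspace_Re_gt)
    fix w assume "w \<in> H"
    then have w: "norm w < norm (1 + w)" "- 1 / 2 < Re w"
      using norm_less_norm_1_plus_iff by (auto simp: H_def)
    then have "1 + w \<noteq> 0" "1 + w \<notin> \<real>\<^sub>\<le>\<^sub>0" by (auto simp: complex_nonpos_Reals_iff)
    then show "(G has_field_derivative k * (w / (1 + w))) (at w within H)"
      unfolding G_def by (auto intro!: derivative_eq_intros simp: divide_simps)
    have "norm (w / (1 + w)) \<le> 1" using w \<open>1 + w \<noteq> 0\<close> by (simp add: norm_divide)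
    then show "norm (k * (w / (1 + w))) \<le> k"
      unfolding norm_mult norm_of_real using k mult_left_mono[of "norm (w / (1 + w))" 1 k] by simp
  qed (use H xy in auto)
  \<comment> \<open>Equal values of the mapping make the two differences equal in modulus, which
    with the contraction factor k < 1 forces both to vanish.\<close>
  moreover have "x / (1 - x) - y / (1 - y) = - cnj (G (x / (1 - x)) - G (y / (1 - y)))"
    using e unfolding G[OF xy(1)] G[OF xy(2)] by (simp add: algebra_simps)
  then have "norm (x / (1 - x) - y / (1 - y)) = norm (G (x / (1 - x)) - G (y / (1 - y)))"
    by (metis complex_mod_cnj norm_minus_cancel)
  ultimately have "(1 - k) * norm (x / (1 - x) - y / (1 - y)) \<le> 0" by (simp add: algebra_simps)
  then have "x / (1 - x) = y / (1 - y)" using k by (simp add: mult_le_0_iff)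
  then show "x = y" using halfplane_map_inj xy by (meson inj_onD)
qed

lemma shifted_geometric_sums:
  fixes z :: "'a::{real_normed_field,banach}"
  assumes "norm z < 1"
  shows "(\<lambda>n. (if n = 0 then 0 else 1) * z ^ n) sums (z / (1 - z))"
proof -
  have "(\<lambda>n. z * z ^ n) sums (z * (1 / (1 - z)))"
    by (intro sums_mult geometric_sums assms)
  then show ?thesis
    using sums_Suc_iff[of "\<lambda>n. (if n = 0 then 0 else 1) * z ^ n" "z / (1 - z)"] by simp
qed

text \<open>Integrating k z/(1-z)^2 gives g and its coefficients k (1 - 1/n). The conditional in
  \<open>b\<close> together with 1/0 = 0 yields b_0 = 0, while b_1 = 0 is automatic.\<close>

lemma extremal_map_hypotheses:
  fixes k K :: real
  assumes k: "0 \<le> k" "k < 1" "K = (1 + k) / (1 - k)"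
  defines "h \<equiv> \<lambda>z::complex. z / (1 - z)"
  defines "g \<equiv> \<lambda>z::complex. k * (z / (1 - z) + Ln (1 - z))"
  defines "a \<equiv> \<lambda>n::nat. (if n = 0 then 0 else 1 :: complex)"
  defines "b \<equiv> \<lambda>n::nat. complex_of_real (k * ((if n = 0 then 0 else 1) - 1 / real n))"
  shows "bohr_hypotheses K (\<lambda>z. h z + cnj (g z)) h g a b h"
proof -
  have ne: "1 - z \<noteq> 0" "1 - z \<notin> \<real>\<^sub>\<le>\<^sub>0" if "z \<in> ball 0 1" for z :: complex
  proof -
    have "Re z < 1" using that complex_Re_le_cmod[of z] by simp
    then show "1 - z \<noteq> 0" "1 - z \<notin> \<real>\<^sub>\<le>\<^sub>0" by (auto simp: complex_nonpos_Reals_iff)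
  qed
  have h': "(h has_field_derivative 1 / (1 - z)\<^sup>2) (at z)" if "z \<in> ball 0 1" for z
    unfolding h_def using ne(1)[OF that]
    by (auto intro!: derivative_eq_intros simp: power2_eq_square)
  have g': "(g has_field_derivative k * (z / (1 - z)\<^sup>2)) (at z)" if "z \<in> ball 0 1" for z :: complex
  proof -
    have "((\<lambda>z. Ln (1 - z)) has_field_derivative - (1 / (1 - z))) (at z)"
      using ne[OF that] by (auto intro!: derivative_eq_intros simp: divide_inverse)
    from DERIV_cmult[OF DERIV_add[OF h'[OF that] this], of k]
    have "(g has_field_derivative k * (1 / (1 - z)\<^sup>2 + - (1 / (1 - z)))) (at z)"
      by (simp add: g_def h_def)
    also have "1 / (1 - z)\<^sup>2 + - (1 / (1 - z)) = z / (1 - z)\<^sup>2"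
    proof -
      have "1 / (1 - z) = (1 - z) / (1 - z)\<^sup>2" using ne(1)[OF that] by (simp add: power2_eq_square)
      also have "\<dots> = 1 / (1 - z)\<^sup>2 - z / (1 - z)\<^sup>2" by (rule diff_divide_distrib)
      finally show ?thesis by (simp only:) simp
    qed
    finally show ?thesis .
  qed
  have hol: "h holomorphic_on ball 0 1" "g holomorphic_on ball 0 1"
    using h' g' by (meson field_differentiable_at_within field_differentiable_def holomorphic_on_def)+
  have d: "deriv h z = 1 / (1 - z)\<^sup>2" "deriv g z = k * (z / (1 - z)\<^sup>2)" if "z \<in> ball 0 1" for z :: complex
    using h'[OF that] g'[OF that] by (auto intro: DERIV_imp_deriv)
  have kz: "k * norm z < 1" "k * norm z \<le> k" if "z \<in> ball 0 1" for z :: complex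
    using mult_left_mono[of "norm z" 1 k] that k by auto
  \<comment> \<open>The mapping is injective on the whole disc, which therefore serves as the
    neighbourhood of every point.\<close>
  have "locally_univalent (\<lambda>z. h z + cnj (g z))"
    unfolding locally_univalent_def h_def g_def
    by (intro ballI exI[of _ "ball 0 1"] conjI extremal_map_inj k open_ball subset_refl)
  moreover have "sense_preserving h g"
    unfolding sense_preserving_def
  proof
    fix z :: complex assume z: "z \<in> ball 0 1"
    have "(k * norm z)\<^sup>2 < 1" using kz(1)[OF z] k by (simp add: power_less_one_iff)
    then have "(norm (1 / (1 - z)\<^sup>2))\<^sup>2 * (k * norm z)\<^sup>2 < (norm (1 / (1 - z)\<^sup>2))\<^sup>2 * 1"
      using ne[OF z] by (intro mult_strict_left_mono) auto
    then show "(norm (deriv h z))\<^sup>2 - (norm (deriv g z))\<^sup>2 > 0"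
      using k by (simp add: d[OF z] norm_mult norm_divide power_mult_distrib power_divide)
  qed
  moreover have "norm (deriv g z / deriv h z) \<le> k" if "z \<in> ball 0 1" for z
    using ne[OF that] kz(2)[OF that] k by (simp add: d[OF that] norm_mult)
  moreover have "canonical_decomposition (\<lambda>z. h z + cnj (g z)) h g"
    unfolding canonical_decomposition_def using hol by (simp add: g_def)
  ultimately have "quasiconformal_harmonic K (\<lambda>z. h z + cnj (g z)) h g"
    unfolding quasiconformal_harmonic_def using harmonic_mapping_add_cnj[OF hol] k by blast
  moreover have hs: "(\<lambda>n. a n * z ^ n) sums h z" if "z \<in> ball 0 1" for z
    unfolding a_def h_def using that by (intro shifted_geometric_sums) auto
  moreover have "(\<lambda>n. b n * z ^ n) sums g z" if "z \<in> ball 0 1" for z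
  proof -
    have "(\<lambda>n. k * (a n * z ^ n + - (z ^ n) / of_nat n)) sums (k * (h z + Ln (1 - z)))"
      using Ln_series'[of "- z"] that by (intro sums_mult sums_add hs) auto
    also have "(\<lambda>n. k * (a n * z ^ n + - (z ^ n) / of_nat n)) = (\<lambda>n. b n * z ^ n)"
      by (auto simp: a_def b_def algebra_simps)
    finally show ?thesis by (simp add: g_def h_def)
  qed
  moreover have "subordinate h h"
    unfolding subordinate_def using hol by (auto intro!: exI[of _ "\<lambda>z. z"] holomorphic_intros)
  moreover have "convex_univalent h"
    unfolding convex_univalent_def using hol halfplane_map_inj halfplane_map_image
    by (simp add: h_def convex_halfspace_Re_gt)
  ultimately show ?thesis unfolding bohr_hypotheses_def by (auto simp: b_def)
qed

text \<open>No coefficient is negative, so the moduli disappear and the sum is h(r) + g(r). Against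
  the distance 1/2 this produces exactly the equation for R.\<close>

lemma extremal_bohr_sum:
  fixes k r :: real
  assumes k: "0 \<le> k" and r: "0 \<le> r" "r < 1"
  shows "bohr_sum (\<lambda>n. (if n = 0 then 0 else 1)) (\<lambda>n. complex_of_real (k * ((if n = 0 then 0 else 1) - 1 / real n))) r
    = R_lhs k r / 2"
proof -
  define \<beta> where "\<beta> = (\<lambda>n. k * ((if n = 0 then 0 else 1) - 1 / real n) * r ^ n)"
  have g: "(\<lambda>n. (if n = 0 then 0 else 1) * r ^ n) sums (r / (1 - r))"
    using r by (intro shifted_geometric_sums) auto
  have "(\<lambda>n. k * ((if n = 0 then 0 else 1) * r ^ n + - (r ^ n) / real n)) sums (k * (r / (1 - r) + ln (1 - r)))"
    using ln_series'[of "- r"] r by (intro sums_mult sums_add g) auto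
  also have "(\<lambda>n. k * ((if n = 0 then 0 else 1) * r ^ n + - (r ^ n) / real n)) = \<beta>"
    by (auto simp: \<beta>_def algebra_simps)
  \<comment> \<open>Shifting by 2 loses nothing because \<beta> vanishes at 0 and 1.\<close>
  finally have "(\<lambda>n. \<beta> (n + 2)) sums (k * (r / (1 - r) + ln (1 - r)))"
    using sums_iff_shift[of \<beta> 2 "k * (r / (1 - r) + ln (1 - r))"] by (simp add: \<beta>_def numeral_2_eq_2)
  moreover have "norm (complex_of_real (k * ((if n + 2 = 0 then 0 else 1) - 1 / real (n + 2)))) * r ^ (n + 2) = \<beta> (n + 2)" for n
    unfolding norm_of_real using k by (simp add: \<beta>_def)
  ultimately have "(\<Sum>n. norm (complex_of_real (k * ((if n + 2 = 0 then 0 else 1) - 1 / real (n + 2)))) * r ^ (n + 2)) =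
      k * (r / (1 - r) + ln (1 - r))" by (simp only: sums_iff)
  moreover have "(\<lambda>n. r ^ (n + 1)) sums (r / (1 - r))"
    using g sums_Suc_iff[of "\<lambda>n. (if n = 0 then 0 else 1) * r ^ n" "r / (1 - r)"] by simp
  ultimately have "bohr_sum (\<lambda>n. (if n = 0 then 0 else 1)) (\<lambda>n. complex_of_real (k * ((if n = 0 then 0 else 1) - 1 / real n))) r
      = r / (1 - r) + k * (r / (1 - r) + ln (1 - r))"
    unfolding bohr_sum_def by (simp add: sums_iff)
  also have "\<dots> = R_lhs k r / 2"
  proof -
    define q where "q = r / (1 - r)"
    have "R_lhs k r = 2 * (1 + k) * q + 2 * k * ln (1 - r)" by (simp add: R_lhs_def q_def)
    then show ?thesis unfolding q_def[symmetric] by (simp add: algebra_simps add_divide_distrib)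
  qed
  finally show ?thesis .
qed

text \<open>Failure of the Bohr inequality calls for an upper bound on the distance, and the single
  frontier point -1/2 provides it.\<close>

lemma infdist_frontier_halfplane: "infdist 0 (frontier {w. - 1 / 2 < Re w}) \<le> 1 / 2"
proof -
  have "frontier {w. 1 \<bullet> w > - 1 / 2} = {w::complex. 1 \<bullet> w = - 1 / 2}"
    by (rule frontier_halfspace_gt) simp
  then have "- 1 / 2 \<in> frontier {w. - 1 / 2 < Re w}" by (simp add: inner_complex_def)
  from infdist_le[OF this, of 0] show ?thesis by simp
qed

text \<open>Unique existence of the roots gives \<open>r_c\<close> and \<open>R_bound\<close> their
  meaning. Summability is stated beside each inequality since \<open>suminf\<close> of a divergent
  series carries no information.\<close>

theorem theorem2:
  fixes K k :: real
  assumes "K \<ge> 1" and "k = (K - 1) / (K + 1)"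
  shows
    "(\<exists>!r. 0 < r \<and> r < 1 \<and> rc_equation k r) \<and>
     (\<exists>!R. 0 < R \<and> R < 1 \<and> R_equation k R) \<and>
     (\<forall>f h g a b \<phi> r. bohr_hypotheses K f h g a b \<phi> \<and> 0 \<le> r \<and> r \<le> r_c k \<longrightarrow>
        summable (\<lambda>n. norm (a (n + 1)) * r ^ (n + 1)) \<and>
        summable (\<lambda>n. norm (b (n + 2)) * r ^ (n + 2)) \<and>
        bohr_sum a b r \<le> infdist (\<phi> 0) (frontier (\<phi> ` unit_disc))) \<and>
     (\<forall>\<rho>. R_bound k < \<rho> \<and> \<rho> < 1 \<longrightarrow>
        (\<exists>f h g a b \<phi> r. bohr_hypotheses K f h g a b \<phi> \<and> 0 \<le> r \<and> r \<le> \<rho> \<and>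
           summable (\<lambda>n. norm (a (n + 1)) * r ^ (n + 1)) \<and>
           summable (\<lambda>n. norm (b (n + 2)) * r ^ (n + 2)) \<and>
           \<not> bohr_sum a b r \<le> infdist (\<phi> 0) (frontier (\<phi> ` unit_disc))))"
proof -
  have k: "0 \<le> k" "k < 1" "K = (1 + k) / (1 - k)"
    unfolding assms(2) using assms(1) by (auto simp: field_simps)
  note ex = rc_equation_ex1[OF k(1)] R_equation_ex1[OF k(1)]
  have rc: "0 < r_c k" "r_c k < 1" "rc_equation k (r_c k)"
    using theI'[OF ex(1)] unfolding r_c_def by auto
  have R: "0 < R_bound k" "R_bound k < 1" "R_equation k (R_bound k)"
    using theI'[OF ex(2)] unfolding R_bound_def by auto
  have upper: "summable (\<lambda>n. norm (a (n + 1)) * r ^ (n + 1)) \<and>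
        summable (\<lambda>n. norm (b (n + 2)) * r ^ (n + 2)) \<and>
        bohr_sum a b r \<le> infdist (\<phi> 0) (frontier (\<phi> ` unit_disc))"
    if hyp: "bohr_hypotheses K f h g a b \<phi>" and r: "0 \<le> r" "r \<le> r_c k" for f h g a b \<phi> r
  proof -
    have "rc_lhs k r \<le> rc_lhs k (r_c k)"
      using rc_lhs_strict_mono[OF k(1) r(1), of "r_c k"] r rc by (cases "r = r_c k") auto
    also have "\<dots> = 1 / 2" using rc(3) by (simp add: rc_equation_def rc_lhs_def)
    finally show ?thesis using bohr_inequality[OF hyp assms(2) r(1)] r rc by auto
  qed
  have sharp: "\<exists>f h g a b \<phi> r. bohr_hypotheses K f h g a b \<phi> \<and> 0 \<le> r \<and> r \<le> \<rho> \<and>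
           summable (\<lambda>n. norm (a (n + 1)) * r ^ (n + 1)) \<and>
           summable (\<lambda>n. norm (b (n + 2)) * r ^ (n + 2)) \<and>
           \<not> bohr_sum a b r \<le> infdist (\<phi> 0) (frontier (\<phi> ` unit_disc))"
    if \<rho>: "R_bound k < \<rho>" "\<rho> < 1" for \<rho>
  proof -
    define h where "h = (\<lambda>z::complex. z / (1 - z))"
    define g where "g = (\<lambda>z::complex. k * (z / (1 - z) + Ln (1 - z)))"
    define a where "a = (\<lambda>n::nat. if n = 0 then 0 else 1 :: complex)"
    define b where "b = (\<lambda>n::nat. complex_of_real (k * ((if n = 0 then 0 else 1) - 1 / real n)))"
    have hyp: "bohr_hypotheses K (\<lambda>z. h z + cnj (g z)) h g a b h"
      unfolding h_def g_def a_def b_def by (rule extremal_map_hypotheses[OF k])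
    then have series: "\<And>z. z \<in> ball 0 1 \<Longrightarrow> (\<lambda>n. a n * z ^ n) sums h z"
      "\<And>z. z \<in> ball 0 1 \<Longrightarrow> (\<lambda>n. b n * z ^ n) sums g z"
      by (auto simp: bohr_hypotheses_def)
    have \<rho>0: "0 \<le> \<rho>" using \<rho> R by simp
    have sa: "summable (\<lambda>n. norm (a n) * \<rho> ^ n)"
      by (rule power_series_summable_norm[OF series(1) \<rho>0 \<rho>(2)])
    have sb: "summable (\<lambda>n. norm (b n) * \<rho> ^ n)"
      by (rule power_series_summable_norm[OF series(2) \<rho>0 \<rho>(2)])
    \<comment> \<open>The inequality already fails at r = \<rho>: strict monotonicity lifts the sum
      above 1/2 there.\<close>
    have "1 = R_lhs k (R_bound k)" using R(3) by (simp add: R_equation_def R_lhs_def)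
    also have "\<dots> < R_lhs k \<rho>" using R \<rho> by (intro R_lhs_strict_mono[OF k(1)]) auto
    also have "R_lhs k \<rho> = 2 * bohr_sum a b \<rho>"
      using extremal_bohr_sum[OF k(1) \<rho>0 \<rho>(2)] by (simp add: a_def b_def)
    finally have "bohr_sum a b \<rho> > 1 / 2" by simp
    moreover have "infdist (h 0) (frontier (h ` unit_disc)) \<le> 1 / 2"
      using infdist_frontier_halfplane unfolding h_def halfplane_map_image by simp
    ultimately have "\<not> bohr_sum a b \<rho> \<le> infdist (h 0) (frontier (h ` unit_disc))" by simp
    moreover have "summable (\<lambda>n. norm (a (n + 1)) * \<rho> ^ (n + 1))"
      by (rule summable_ignore_initial_segment[OF sa])
    moreover have "summable (\<lambda>n. norm (b (n + 2)) * \<rho> ^ (n + 2))"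
      by (rule summable_ignore_initial_segment[OF sb])
    ultimately show ?thesis using hyp \<rho>0 by (intro exI conjI) (assumption | rule order_refl)+
  qed
  show ?thesis
    by (intro conjI ex allI impI; (elim conjE)?) (use upper sharp in simp_all)
qed

end
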